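(* Let $\ell_1,\ell_2>0$. Let $x(t)m_1(t)$, $t\in[0,T]$, be a bicycling geodesic of the 1-linkage of length $\ell_1$. Let $m_2(0)$ be a point with $|x(0)m_2(0)|=\ell_2$ and $m_2(0)\neq m_1(0)$, and let $m_2(t)$, $t\in[0,T]$, be the motion uniquely determined by $m_2(0)$ and the conditions that $|x(t)m_2(t)|=\ell_2$ and the velocity of $m_2(t)$ is parallel to the segment $x(t)m_2(t)$ for all $t$. Then the resulting horizontal path $x(t)m_1(t)m_2(t)$ in the 2-linkage configuration space ${\mathcal C}$ is a geodesic.
   Context: 1-linkage of length $\ell_1$: an oriented segment $xm_1$ in the plane of fixed length $\ell_1$, moving so that the velocity of $m_1$ is parallel to the segment (no-slip condition); such motions are called horizontal. The length of a horizontal path is the length of the trajectory of $x$. A bicycling geodesic is a horizontal path that locally minimizes length: for any two of its sufficiently close points, its segment between them is a shortest horizontal path with the same end configurations. 2-linkage: a triple $x,m_1,m_2\in\mathbb{R}^2$ with $|xm_1|=\ell_1$, $|xm_2|=\ell_2$ fixed, $m_1\neq m_2$; ${\mathcal C}$ is the 4-dimensional space of such configurations. A path in ${\mathcal C}$ is horizontal if the velocity of $m_i$ is parallel to the segment $xm_i$ for $i=1,2$; its length is the length of the trajectory of $x$. A geodesic in ${\mathcal C}$ is a horizontal path that locally minimizes length among horizontal paths with the same end configurations. *)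

theory Defs
  imports "HOL-Analysis.Analysis"
begin

text \<open>
  Paths are functions of a real parameter, considered only on an interval \<open>{a..b}\<close> with \<open>a < b\<close>;
  the velocity is the vector derivative within \<open>{a..b}\<close>, hence one-sided at the endpoints. Paths
  are of class \<open>C\<^sup>1\<close>, so that the velocity exists at every time and the length is its integral.
  The velocity may vanish, so corners and cusps are not excluded: every piecewise \<open>C\<^sup>1\<close> path
  becomes \<open>C\<^sup>1\<close> after a reparametrization that stops at the break points.
\<close>

definition velocity :: "real \<Rightarrow> real \<Rightarrow> (real \<Rightarrow> real^2) \<Rightarrow> real \<Rightarrow> real^2"
  where "velocity a b f t = vector_derivative f (at t within {a..b})"

definition C1_path :: "real \<Rightarrow> real \<Rightarrow> (real \<Rightarrow> real^2) \<Rightarrow> bool"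
  where "C1_path a b f \<longleftrightarrow>
    (\<forall>t\<in>{a..b}. f differentiable (at t within {a..b})) \<and>
    continuous_on {a..b} (velocity a b f)"

definition arc_length :: "real \<Rightarrow> real \<Rightarrow> (real \<Rightarrow> real^2) \<Rightarrow> real"
  where "arc_length a b f = integral {a..b} (\<lambda>t. norm (velocity a b f t))"

definition no_slip :: "real \<Rightarrow> real \<Rightarrow> (real \<Rightarrow> real^2) \<Rightarrow> (real \<Rightarrow> real^2) \<Rightarrow> bool"
  where "no_slip a b x m \<longleftrightarrow>
    (\<forall>t\<in>{a..b}. \<exists>c. velocity a b m t = c *\<^sub>R (m t - x t))"

definition config1 :: "real \<Rightarrow> ((real^2) \<times> (real^2)) set"
  where "config1 l = {(x, m). dist x m = l}"

definition horizontal1 ::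
  "real \<Rightarrow> real \<Rightarrow> real \<Rightarrow> (real \<Rightarrow> real^2) \<Rightarrow> (real \<Rightarrow> real^2) \<Rightarrow> bool"
  where "horizontal1 l a b x m \<longleftrightarrow>
    a < b \<and> C1_path a b x \<and> C1_path a b m \<and>
    (\<forall>t\<in>{a..b}. (x t, m t) \<in> config1 l) \<and>
    no_slip a b x m"

text \<open>Competitors may be parametrized over any interval \<open>{c..d}\<close>.\<close>

definition shortest1 ::
  "real \<Rightarrow> real \<Rightarrow> real \<Rightarrow> (real \<Rightarrow> real^2) \<Rightarrow> (real \<Rightarrow> real^2) \<Rightarrow> bool"
  where "shortest1 l a b x m \<longleftrightarrow>
    horizontal1 l a b x m \<and>
    (\<forall>c d y n. horizontal1 l c d y n \<and>
       (y c, n c) = (x a, m a) \<and> (y d, n d) = (x b, m b)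
       \<longrightarrow> arc_length a b x \<le> arc_length c d y)"

text \<open>
  ``Sufficiently close points'' are points whose parameters differ by less than some
  \<open>\<delta> > 0\<close>; by compactness of \<open>{a..b}\<close>, a uniform \<open>\<delta>\<close> is no restriction.
\<close>

definition bicycling_geodesic ::
  "real \<Rightarrow> real \<Rightarrow> real \<Rightarrow> (real \<Rightarrow> real^2) \<Rightarrow> (real \<Rightarrow> real^2) \<Rightarrow> bool"
  where "bicycling_geodesic l a b x m \<longleftrightarrow>
    horizontal1 l a b x m \<and>
    (\<exists>\<delta>>0. \<forall>s t. a \<le> s \<and> s < t \<and> t \<le> b \<and> t - s < \<delta> \<longrightarrow> shortest1 l s t x m)"

definition config2 :: "real \<Rightarrow> real \<Rightarrow> ((real^2) \<times> (real^2) \<times> (real^2)) set"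
  where "config2 l1 l2 = {(x, m1, m2). dist x m1 = l1 \<and> dist x m2 = l2 \<and> m1 \<noteq> m2}"

definition horizontal2 ::
  "real \<Rightarrow> real \<Rightarrow> real \<Rightarrow> real \<Rightarrow>
    (real \<Rightarrow> real^2) \<Rightarrow> (real \<Rightarrow> real^2) \<Rightarrow> (real \<Rightarrow> real^2) \<Rightarrow> bool"
  where "horizontal2 l1 l2 a b x m1 m2 \<longleftrightarrow>
    a < b \<and> C1_path a b x \<and> C1_path a b m1 \<and> C1_path a b m2 \<and>
    (\<forall>t\<in>{a..b}. (x t, m1 t, m2 t) \<in> config2 l1 l2) \<and>
    no_slip a b x m1 \<and> no_slip a b x m2"

definition shortest2 ::
  "real \<Rightarrow> real \<Rightarrow> real \<Rightarrow> real \<Rightarrow>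
    (real \<Rightarrow> real^2) \<Rightarrow> (real \<Rightarrow> real^2) \<Rightarrow> (real \<Rightarrow> real^2) \<Rightarrow> bool"
  where "shortest2 l1 l2 a b x m1 m2 \<longleftrightarrow>
    horizontal2 l1 l2 a b x m1 m2 \<and>
    (\<forall>c d y n1 n2. horizontal2 l1 l2 c d y n1 n2 \<and>
       (y c, n1 c, n2 c) = (x a, m1 a, m2 a) \<and> (y d, n1 d, n2 d) = (x b, m1 b, m2 b)
       \<longrightarrow> arc_length a b x \<le> arc_length c d y)"

definition geodesic2 ::
  "real \<Rightarrow> real \<Rightarrow> real \<Rightarrow> real \<Rightarrow>
    (real \<Rightarrow> real^2) \<Rightarrow> (real \<Rightarrow> real^2) \<Rightarrow> (real \<Rightarrow> real^2) \<Rightarrow> bool"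
  where "geodesic2 l1 l2 a b x m1 m2 \<longleftrightarrow>
    horizontal2 l1 l2 a b x m1 m2 \<and>
    (\<exists>\<delta>>0. \<forall>s t. a \<le> s \<and> s < t \<and> t \<le> b \<and> t - s < \<delta> \<longrightarrow> shortest2 l1 l2 s t x m1 m2)"

end

theory Submission
  imports Defs
begin

text \<open>
  Forgetting the second rod turns every horizontal path of the 2-linkage into a horizontal path of
  the 1-linkage with the same point \<open>x\<close>, hence of the same length. A competitor for the end
  configurations of the 2-linkage is therefore also one for those of the 1-linkage, so minimality
  on short intervals is inherited, with the same \<open>\<delta>\<close>.

  What remains is that the lifted path is a horizontal path in the configuration space of the
  2-linkage, and that this survives restriction to subintervals. Everything rests on one formula:
  differentiating the rod length shows that the no-slip condition is the differential equation
  \<open>m' = ((x' \<bullet> (m - x)) / l\<^sup>2) (m - x)\<close>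
  (lemma \<open>trailing_velocity\<close>). Its right-hand side is continuous, so \<open>m\<^sub>2\<close> is \<open>C\<^sup>1\<close>; and it is
  the same equation for two rods of equal length, so by uniqueness of solutions their free ends
  never collide unless they coincide from the beginning (lemma \<open>trailing_points_stay_distinct\<close>).
  Rods of different lengths cannot collide at all.
\<close>

lemma has_velocity:
  assumes "f differentiable (at t within {a..b})"
  shows "(f has_vector_derivative velocity a b f t) (at t within {a..b})"
  using assms unfolding velocity_def by (simp add: vector_derivative_works)

lemma velocity_subinterval:
  assumes "f differentiable (at t within {a..b})" "a \<le> c" "c < d" "d \<le> b" "t \<in> {c..d}"
  shows "velocity c d f t = velocity a b f t"
proof -
  have "(f has_vector_derivative velocity a b f t) (at t within {c..d})"
    using has_velocity[OF assms(1)] assms by (auto intro: has_vector_derivative_within_subset)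
  then show ?thesis
    using assms vector_derivative_within_cbox[of c d t f]
    unfolding velocity_def[of c d] by simp
qed

lemma C1_path_subinterval:
  assumes "C1_path a b f" "a \<le> c" "c < d" "d \<le> b"
  shows "C1_path c d f"
proof -
  have sub: "{c..d} \<subseteq> {a..b}"
    using assms by auto
  have diff: "f differentiable (at t within {a..b})" if "t \<in> {c..d}" for t
    using assms(1) sub that unfolding C1_path_def by auto
  have "continuous_on {c..d} (velocity a b f)"
    using assms(1) sub unfolding C1_path_def by (auto intro: continuous_on_subset)
  then have "continuous_on {c..d} (velocity c d f)"
    by (rule continuous_on_eq) (simp add: velocity_subinterval[OF diff assms(2-4)])
  then show ?thesis
    using differentiable_within_subset[OF diff sub] unfolding C1_path_def by blast
qed

lemma no_slip_subinterval:
  assumes "no_slip a b x m" "\<forall>t\<in>{a..b}. m differentiable (at t within {a..b})"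
    and "a \<le> c" "c < d" "d \<le> b"
  shows "no_slip c d x m"
  unfolding no_slip_def
proof
  fix t assume t: "t \<in> {c..d}"
  then have "t \<in> {a..b}"
    using assms by auto
  then show "\<exists>k. velocity c d m t = k *\<^sub>R (m t - x t)"
    using assms t velocity_subinterval[of m t a b c d] unfolding no_slip_def by auto
qed

lemma horizontal2_subinterval:
  assumes "horizontal2 l1 l2 a b x m1 m2" "a \<le> c" "c < d" "d \<le> b"
  shows "horizontal2 l1 l2 c d x m1 m2"
proof -
  have "\<forall>t\<in>{a..b}. m1 differentiable (at t within {a..b})"
    and "\<forall>t\<in>{a..b}. m2 differentiable (at t within {a..b})"
    using assms(1) unfolding horizontal2_def C1_path_def by auto
  then show ?thesis
    using assms C1_path_subinterval[OF _ assms(2-4)] no_slip_subinterval[OF _ _ assms(2-4)]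
    unfolding horizontal2_def by auto
qed

lemma continuous_on_if_differentiable_within:
  assumes "\<forall>t\<in>S. f differentiable (at t within S)"
  shows "continuous_on S f"
  using assms by (simp add: continuous_on_eq_continuous_within differentiable_imp_continuous_within)

text \<open>
  Since \<open>(m - x) \<bullet> (m - x)\<close> is constant, \<open>m'\<close> and \<open>x'\<close> have the same component along the rod;
  by the no-slip condition \<open>m'\<close> has no other component.
\<close>

lemma trailing_velocity:
  assumes "a < b" "l > 0" and t: "t \<in> {a..b}"
    and x: "x differentiable (at t within {a..b})"
    and m: "m differentiable (at t within {a..b})"
    and len: "\<forall>t\<in>{a..b}. dist (x t) (m t) = l"
    and "no_slip a b x m"
  shows "velocity a b m t = ((velocity a b x t \<bullet> (m t - x t)) / l\<^sup>2) *\<^sub>R (m t - x t)"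
proof -
  define r where "r = (\<lambda>t. m t - x t)"
  have sq: "r s \<bullet> r s = l\<^sup>2" if "s \<in> {a..b}" for s
    using len that by (simp add: r_def dot_square_norm dist_norm norm_minus_commute)
  obtain c where c: "velocity a b m t = c *\<^sub>R r t"
    using \<open>no_slip a b x m\<close> t unfolding no_slip_def r_def by blast
  have "(r has_vector_derivative (velocity a b m t - velocity a b x t)) (at t within {a..b})"
    unfolding r_def by (intro derivative_intros has_velocity x m)
  then have "((\<lambda>s. r s \<bullet> r s) has_vector_derivative
      (r t \<bullet> (velocity a b m t - velocity a b x t) + (velocity a b m t - velocity a b x t) \<bullet> r t))
      (at t within {a..b})"
    by (rule bounded_bilinear.has_vector_derivative[OF bounded_bilinear_inner]) fact
  moreover have "((\<lambda>s. r s \<bullet> r s) has_vector_derivative 0) (at t within {a..b})"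
    by (rule has_vector_derivative_transform[OF t, where f = "\<lambda>_. l\<^sup>2"])
      (use sq in \<open>auto intro: derivative_intros\<close>)
  ultimately have "r t \<bullet> (velocity a b m t - velocity a b x t)
      + (velocity a b m t - velocity a b x t) \<bullet> r t = 0"
    using vector_derivative_within_cbox[of a b t] \<open>a < b\<close> t
    by (metis box_real(2))
  then have "c * l\<^sup>2 = velocity a b x t \<bullet> r t"
    using sq[OF t] by (simp add: c inner_diff_left inner_diff_right inner_commute)
  then have "c = (velocity a b x t \<bullet> r t) / l\<^sup>2"
    using \<open>l > 0\<close> by (simp add: field_simps)
  then show ?thesis
    by (simp add: c r_def)
qed

lemma trailing_path_C1:
  assumes "a < b" "l > 0" and x: "C1_path a b x"
    and m: "\<forall>t\<in>{a..b}. m differentiable (at t within {a..b})"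
    and len: "\<forall>t\<in>{a..b}. dist (x t) (m t) = l"
    and slip: "no_slip a b x m"
  shows "C1_path a b m"
proof -
  have dx: "\<forall>t\<in>{a..b}. x differentiable (at t within {a..b})"
    and cv: "continuous_on {a..b} (velocity a b x)"
    using x unfolding C1_path_def by auto
  have "continuous_on {a..b}
      (\<lambda>t. ((velocity a b x t \<bullet> (m t - x t)) / l\<^sup>2) *\<^sub>R (m t - x t))"
    using \<open>l > 0\<close>
    by (intro continuous_intros cv continuous_on_if_differentiable_within[OF dx]
        continuous_on_if_differentiable_within[OF m]) auto
  then have "continuous_on {a..b} (velocity a b m)"
    by (rule continuous_on_eq) (use trailing_velocity[OF assms(1,2) _ _ _ len slip] dx m in simp)
  then show ?thesis
    using m unfolding C1_path_def by auto
qed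

text \<open>
  A backward Gronwall estimate. The one-sided bound on \<open>f'\<close> makes \<open>t \<mapsto> f t * exp (K * t)\<close>
  nondecreasing, so \<open>f\<close> cannot reach zero from a positive value.
\<close>

lemma nonneg_zero_propagates_backwards:
  fixes f f' :: "real \<Rightarrow> real"
  assumes "a \<le> t" "t \<le> b" "f t = 0" "f a \<ge> 0"
    and der: "\<And>s. s \<in> {a..b} \<Longrightarrow> (f has_real_derivative f' s) (at s within {a..b})"
    and bound: "\<And>s. s \<in> {a..b} \<Longrightarrow> f' s \<ge> - K * f s"
  shows "f a = 0"
proof -
  have sub: "{a..t} \<subseteq> {a..b}"
    using assms by auto
  have der_exp: "((\<lambda>s. f s * exp (K * s)) has_real_derivative (f' s + K * f s) * exp (K * s))
      (at s within {a..b})" if "s \<in> {a..b}" for s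
    by (auto intro!: derivative_eq_intros der that simp: algebra_simps)
  have "f a * exp (K * a) \<le> f t * exp (K * t)"
  proof (rule DERIV_nonneg_imp_increasing_open[OF \<open>a \<le> t\<close>])
    show "continuous_on {a..t} (\<lambda>s. f s * exp (K * s))"
      using DERIV_continuous_on[OF der_exp] sub by (rule continuous_on_subset)
  next
    fix s assume s: "a < s" "s < t"
    then have "((\<lambda>s. f s * exp (K * s)) has_real_derivative (f' s + K * f s) * exp (K * s)) (at s)"
      using der_exp[of s] \<open>t \<le> b\<close> at_within_Icc_at[of a s b] by auto
    moreover have "(f' s + K * f s) * exp (K * s) \<ge> 0"
      using bound[of s] s \<open>t \<le> b\<close> by simp
    ultimately show "\<exists>y. ((\<lambda>s. f s * exp (K * s)) has_real_derivative y) (at s) \<and> y \<ge> 0"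
      by blast
  qed
  then show ?thesis
    using assms by (simp add: mult_le_0_iff)
qed

text \<open>
  For rods \<open>r\<^sub>i = m\<^sub>i - x\<close> of equal length, \<open>(m\<^sub>1 - m\<^sub>2) \<bullet> r\<^sub>1 = \<parallel>m\<^sub>1 - m\<^sub>2\<parallel>\<^sup>2 / 2\<close>. Hence the squared
  distance \<open>f\<close> of the free ends satisfies \<open>f' = (x' \<bullet> (r\<^sub>1 + r\<^sub>2) / l\<^sup>2) f\<close>, a linear equation with
  bounded coefficient.
\<close>

lemma trailing_points_stay_distinct:
  assumes "a < b" "l > 0" and x: "C1_path a b x"
    and m1: "\<forall>t\<in>{a..b}. m1 differentiable (at t within {a..b})"
    and m2: "\<forall>t\<in>{a..b}. m2 differentiable (at t within {a..b})"
    and len1: "\<forall>t\<in>{a..b}. dist (x t) (m1 t) = l"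
    and len2: "\<forall>t\<in>{a..b}. dist (x t) (m2 t) = l"
    and slip1: "no_slip a b x m1" and slip2: "no_slip a b x m2"
    and "m1 a \<noteq> m2 a" and t: "t \<in> {a..b}"
  shows "m1 t \<noteq> m2 t"
proof
  assume eq: "m1 t = m2 t"
  define r1 where "r1 = (\<lambda>s. m1 s - x s)"
  define r2 where "r2 = (\<lambda>s. m2 s - x s)"
  define u where "u = (\<lambda>s. m1 s - m2 s)"
  define g where "g = (\<lambda>s. (velocity a b x s \<bullet> (r1 s + r2 s)) / l\<^sup>2)"
  have dx: "\<forall>s\<in>{a..b}. x differentiable (at s within {a..b})"
    and cv: "continuous_on {a..b} (velocity a b x)"
    using x unfolding C1_path_def by auto
  have "continuous_on {a..b} g"
    unfolding g_def r1_def r2_def using \<open>l > 0\<close>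
    by (intro continuous_intros cv continuous_on_if_differentiable_within[OF dx]
        continuous_on_if_differentiable_within[OF m1]
        continuous_on_if_differentiable_within[OF m2]) auto
  then have "compact (g ` {a..b})"
    by (intro compact_continuous_image) auto
  then obtain K where K: "\<And>s. s \<in> {a..b} \<Longrightarrow> norm (g s) \<le> K"
    using compact_imp_bounded bounded_iff by (metis imageI)
  have der: "((\<lambda>s. u s \<bullet> u s) has_real_derivative g s * (u s \<bullet> u s)) (at s within {a..b})"
    if s: "s \<in> {a..b}" for s
  proof -
    let ?v = "velocity a b x s" and ?w = "velocity a b m1 s - velocity a b m2 s"
    have w: "?w = ((?v \<bullet> r1 s) / l\<^sup>2) *\<^sub>R r1 s - ((?v \<bullet> r2 s) / l\<^sup>2) *\<^sub>R r2 s"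
      using trailing_velocity[OF assms(1,2) s _ _ len1 slip1]
        trailing_velocity[OF assms(1,2) s _ _ len2 slip2] dx m1 m2 s
      by (simp add: r1_def r2_def)
    have u: "u s = r1 s - r2 s"
      by (simp add: u_def r1_def r2_def)
    have sq: "r1 s \<bullet> r1 s = l\<^sup>2" "r2 s \<bullet> r2 s = l\<^sup>2"
      using len1 len2 s by (simp_all add: r1_def r2_def dot_square_norm dist_norm norm_minus_commute)
    have val: "u s \<bullet> ?w + ?w \<bullet> u s = g s * (u s \<bullet> u s)"
      using \<open>l > 0\<close> unfolding w u g_def
      by (simp add: inner_diff_left inner_diff_right inner_add_left inner_add_right sq
          inner_commute[of "r2 s" "r1 s"] field_simps power2_eq_square)
    have "(u has_vector_derivative ?w) (at s within {a..b})"
      unfolding u_def using m1 m2 s by (intro derivative_intros has_velocity) auto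
    then have "((\<lambda>s. u s \<bullet> u s) has_vector_derivative (u s \<bullet> ?w + ?w \<bullet> u s)) (at s within {a..b})"
      by (rule bounded_bilinear.has_vector_derivative[OF bounded_bilinear_inner]) fact
    then show ?thesis
      by (simp add: val has_real_derivative_iff_has_vector_derivative)
  qed
  have "u a \<bullet> u a = 0"
  proof (rule nonneg_zero_propagates_backwards[where f = "\<lambda>s. u s \<bullet> u s" and t = t and K = K,
        OF _ _ _ _ der])
    fix s assume "s \<in> {a..b}"
    then have "- K \<le> g s"
      using K by fastforce
    then show "- K * (u s \<bullet> u s) \<le> g s * (u s \<bullet> u s)"
      by (rule mult_right_mono) simp
  qed (use t eq in \<open>auto simp: u_def\<close>)
  then show False
    using \<open>m1 a \<noteq> m2 a\<close> by (simp add: u_def)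
qed

lemma horizontal2_imp_horizontal1:
  "horizontal2 l1 l2 a b x m1 m2 \<Longrightarrow> horizontal1 l1 a b x m1"
  unfolding horizontal2_def horizontal1_def config1_def config2_def by auto

lemma shortest2_if_shortest1:
  assumes "horizontal2 l1 l2 a b x m1 m2" "shortest1 l1 a b x m1"
  shows "shortest2 l1 l2 a b x m1 m2"
  using assms unfolding shortest2_def shortest1_def by (auto dest!: horizontal2_imp_horizontal1)

lemma geodesic2_if_bicycling_geodesic:
  assumes hor: "horizontal2 l1 l2 a b x m1 m2" and "bicycling_geodesic l1 a b x m1"
  shows "geodesic2 l1 l2 a b x m1 m2"
proof -
  obtain \<delta> where "\<delta> > 0"
    and \<delta>: "\<And>s t. a \<le> s \<Longrightarrow> s < t \<Longrightarrow> t \<le> b \<Longrightarrow> t - s < \<delta> \<Longrightarrow> shortest1 l1 s t x m1"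
    using assms(2) unfolding bicycling_geodesic_def by blast
  have "shortest2 l1 l2 s t x m1 m2" if "a \<le> s" "s < t" "t \<le> b" "t - s < \<delta>" for s t
    using shortest2_if_shortest1 horizontal2_subinterval[OF hor] \<delta> that by blast
  then show ?thesis
    unfolding geodesic2_def using hor \<open>\<delta> > 0\<close> by blast
qed

theorem proposition5p3:
  fixes l1 l2 T :: real
    and x m1 m2 :: "real \<Rightarrow> real^2"
  assumes "l1 > 0" and "l2 > 0" and "T > 0"
    and "bicycling_geodesic l1 0 T x m1"
    and "dist (x 0) (m2 0) = l2" and "m2 0 \<noteq> m1 0"
    and "\<forall>t\<in>{0..T}. m2 differentiable (at t within {0..T})"
    and "\<forall>t\<in>{0..T}. dist (x t) (m2 t) = l2"
    and "no_slip 0 T x m2"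
  shows "geodesic2 l1 l2 0 T x m1 m2"
proof (rule geodesic2_if_bicycling_geodesic)
  have x: "C1_path 0 T x" and m1: "C1_path 0 T m1" and slip1: "no_slip 0 T x m1"
    and len1: "\<forall>t\<in>{0..T}. dist (x t) (m1 t) = l1"
    using \<open>bicycling_geodesic l1 0 T x m1\<close>
    unfolding bicycling_geodesic_def horizontal1_def config1_def by auto
  have "m1 t \<noteq> m2 t" if t: "t \<in> {0..T}" for t
  proof (cases "l1 = l2")
    case True
    then show ?thesis
      using trailing_points_stay_distinct[of 0 T l1 x m1 m2 t] assms x m1 slip1 len1 t
      unfolding C1_path_def by auto
  next
    case False
    then show ?thesis
      using len1 assms t by metis
  qed
  then show "horizontal2 l1 l2 0 T x m1 m2"
    using assms x m1 slip1 len1 trailing_path_C1[of 0 T l2 x m2]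
    unfolding horizontal2_def config2_def by auto
qed fact

end
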